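(* Let $F$ be a clause-set and $F=(F_0,C)\diamond G$ a clause-factorisation. (1) $F_0$ and $G$ are both unsatisfiable hitting clause-sets if and only if $F$ is an unsatisfiable hitting clause-set. (2) Assume $F$ is a nonsingular unsatisfiable hitting clause-set. (a) If $F$ is not strictly fs-resolvable, then neither $F_0$ nor $G$ has a $1$-singular variable. (b) $\mathrm{nsv}(F_0)\le|\mathrm{varsing}(F_0)\cap\mathrm{var}(G)|+1\le|\mathrm{var}(F_0)\cap\mathrm{var}(G)|+1\le\delta(F)$. (c) $\mathrm{nsv}(G)\le|\mathrm{var}(F_0)\cap\mathrm{varsing}(G)|\le|\mathrm{var}(F_0)\cap\mathrm{var}(G)|\le\delta(F)-1$.
   Context: Variables are positive integers, literals are nonzero integers, the complement of $x$ is $\overline{x}=-x$. A clause is a finite set of literals with no pair $x,\overline{x}$; a clause-set is a finite set of clauses. $\mathrm{var}(F)$ is the set of variables occurring in $F$, $n(F)=|\mathrm{var}(F)|$, $c(F)=|F|$, $\delta(F)=c(F)-n(F)$. $F$ is satisfiable if some clause meets every clause of $F$, otherwise unsatisfiable. $F$ is hitting if any two distinct clauses $A,B\in F$ have some $x\in A$ with $\overline{x}\in B$. $\mathrm{ldeg}_F(x)$ is the number of clauses of $F$ containing $x$. A variable $v\in\mathrm{var}(F)$ is singular if $\min(\mathrm{ldeg}_F(v),\mathrm{ldeg}_F(\overline v))=1$, and $1$-singular if moreover $\mathrm{ldeg}_F(v)+\mathrm{ldeg}_F(\overline v)=2$. $\mathrm{varsing}(F)$ is the set of singular variables of $F$,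 $\mathrm{nsv}(F)=|\mathrm{varsing}(F)|$; $F$ is nonsingular if $\mathrm{varsing}(F)=\emptyset$. For clause-sets $F_0,G$ and $C\in F_0$, $(F_0,C)\diamond G:=(F_0\setminus\{C\})\cup\{C\cup D: D\in G, C\cap\overline D=\emptyset\}$; this is a clause-factorisation if $\mathrm{var}(C)\cap\mathrm{var}(G)=\emptyset$, the two sets in the union are disjoint, and $G$ is unsatisfiable. An fs-pair is $\{E\cup\{w\},E\cup\{\overline w\}\}$ with $w,\overline w\notin E$; fs-resolution replaces an fs-pair $\{E\cup\{w\},E\cup\{\overline w\}\}\subseteq F$ with $E\notin F$ by $E$; it is strict if the result has the same variable set as $F$; $F$ is strictly fs-resolvable if some strict fs-resolution is possible on $F$. *)

theory Defs
  imports Main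
begin

text \<open>Literals are nonzero integers, variables are the positive ones; the complement is
  \<^term>\<open>uminus\<close>, and the variable of a literal is its absolute value.\<close>

definition complement :: "int set \<Rightarrow> int set" where
  "complement L = uminus ` L"

definition clause :: "int set \<Rightarrow> bool" where
  "clause C \<longleftrightarrow> finite C \<and> 0 \<notin> C \<and> C \<inter> complement C = {}"

definition clause_set :: "int set set \<Rightarrow> bool" where
  "clause_set F \<longleftrightarrow> finite F \<and> (\<forall>C\<in>F. clause C)"

definition var_clause :: "int set \<Rightarrow> int set" where
  "var_clause C = abs ` C"

definition var :: "int set set \<Rightarrow> int set" where
  "var F = (\<Union>C\<in>F. var_clause C)"

definition num_var :: "int set set \<Rightarrow> nat" where
  "num_var F = card (var F)"

definition num_cls :: "int set set \<Rightarrow> nat" where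
  "num_cls F = card F"

definition deficiency :: "int set set \<Rightarrow> int" where
  "deficiency F = int (num_cls F) - int (num_var F)"

definition satisfiable :: "int set set \<Rightarrow> bool" where
  "satisfiable F \<longleftrightarrow> (\<exists>P. clause P \<and> (\<forall>C\<in>F. P \<inter> C \<noteq> {}))"

abbreviation unsatisfiable :: "int set set \<Rightarrow> bool" where
  "unsatisfiable F \<equiv> \<not> satisfiable F"

definition hitting :: "int set set \<Rightarrow> bool" where
  "hitting F \<longleftrightarrow> (\<forall>A\<in>F. \<forall>B\<in>F. A \<noteq> B \<longrightarrow> (\<exists>x\<in>A. - x \<in> B))"

definition unsat_hitting_clause_set :: "int set set \<Rightarrow> bool" where
  "unsat_hitting_clause_set F \<longleftrightarrow> clause_set F \<and> unsatisfiable F \<and> hitting F"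

definition ldeg :: "int set set \<Rightarrow> int \<Rightarrow> nat" where
  "ldeg F x = card {C \<in> F. x \<in> C}"

definition singular_var :: "int set set \<Rightarrow> int \<Rightarrow> bool" where
  "singular_var F v \<longleftrightarrow> v \<in> var F \<and> min (ldeg F v) (ldeg F (- v)) = 1"

definition one_singular_var :: "int set set \<Rightarrow> int \<Rightarrow> bool" where
  "one_singular_var F v \<longleftrightarrow> singular_var F v \<and> ldeg F v + ldeg F (- v) = 2"

definition varsing :: "int set set \<Rightarrow> int set" where
  "varsing F = {v. singular_var F v}"

definition nsv :: "int set set \<Rightarrow> nat" where
  "nsv F = card (varsing F)"

definition nonsingular :: "int set set \<Rightarrow> bool" where
  "nonsingular F \<longleftrightarrow> varsing F = {}"

definition extend_clause :: "int set \<Rightarrow> int set set \<Rightarrow> int set set" where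
  "extend_clause C G = {C \<union> D | D. D \<in> G \<and> C \<inter> complement D = {}}"

text \<open>\<open>diamond F0 C G\<close> is \<open>(F0, C) \<diamond> G\<close>.\<close>

definition diamond :: "int set set \<Rightarrow> int set \<Rightarrow> int set set \<Rightarrow> int set set" where
  "diamond F0 C G = (F0 - {C}) \<union> extend_clause C G"

definition clause_factorisation :: "int set set \<Rightarrow> int set \<Rightarrow> int set set \<Rightarrow> bool" where
  "clause_factorisation F0 C G \<longleftrightarrow>
     clause_set F0 \<and> clause_set G \<and> C \<in> F0 \<and>
     var_clause C \<inter> var G = {} \<and>
     (F0 - {C}) \<inter> extend_clause C G = {} \<and>
     unsatisfiable G"

definition fs_resolution :: "int set set \<Rightarrow> int set set \<Rightarrow> bool" where
  "fs_resolution F F' \<longleftrightarrow>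
     (\<exists>E w. w \<noteq> 0 \<and> clause E \<and> w \<notin> E \<and> - w \<notin> E \<and>
        {E \<union> {w}, E \<union> {- w}} \<subseteq> F \<and> E \<notin> F \<and>
        F' = (F - {E \<union> {w}, E \<union> {- w}}) \<union> {E})"

definition strict_fs_resolution :: "int set set \<Rightarrow> int set set \<Rightarrow> bool" where
  "strict_fs_resolution F F' \<longleftrightarrow> fs_resolution F F' \<and> var F' = var F"

definition strictly_fs_resolvable :: "int set set \<Rightarrow> bool" where
  "strictly_fs_resolvable F \<longleftrightarrow> (\<exists>F'. strict_fs_resolution F F')"

end

theory Submission
  imports Defs
begin

text \<open>Since \<open>C\<close> and \<open>G\<close> share no variable, \<open>D \<mapsto> C \<union> D\<close> is injective on \<open>G\<close> and literal degrees
  of \<open>F\<close> are sums of those of \<open>F0\<close> and \<open>G\<close>, except at the literals of \<open>C\<close>. A clause of \<open>F0\<close> that did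
  not clash with \<open>C\<close> would clash with every clause of \<open>G\<close>, so its complement would satisfy \<open>G\<close>; this
  gives (1). If \<open>F\<close> is nonsingular, a singular variable of \<open>G\<close> must also occur in \<open>F0\<close>, and a singular
  variable of \<open>F0\<close> outside \<open>G\<close> must come from a literal of \<open>C\<close> occurring in no other clause of \<open>F0\<close>;
  a clause of an unsatisfiable hitting clause-set contains at most one such literal. A 1-singular
  variable yields an fs-pair, which survives in \<open>F\<close>. The bounds by the deficiency come from
  \<open>\<delta>(F) = \<delta>(F0) + \<delta>(G) - 1 + |var F0 \<inter> var G|\<close> together with Tarsi's lemma \<open>\<delta> \<ge> 1\<close>, proved by
  a Hall-type argument.\<close>

section \<open>Literals, variables and degrees\<close>

lemma mem_complement_iff [simp]: "x \<in> complement L \<longleftrightarrow> - x \<in> L"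
  unfolding complement_def by (metis imageE image_eqI minus_minus)

lemma clause_iff: "clause A \<longleftrightarrow> finite A \<and> 0 \<notin> A \<and> (\<forall>x\<in>A. - x \<notin> A)"
  unfolding clause_def by auto

lemma clause_setD: "clause_set F \<Longrightarrow> A \<in> F \<Longrightarrow> clause A"
  by (simp add: clause_set_def)

lemma clause_set_finite: "clause_set F \<Longrightarrow> finite F"
  by (simp add: clause_set_def)

lemma clause_set_subset: "clause_set F \<Longrightarrow> H \<subseteq> F \<Longrightarrow> clause_set H"
  by (auto simp: clause_set_def finite_subset)

lemma clause_complement: "clause A \<Longrightarrow> clause (complement A)"
  by (auto simp: clause_iff complement_def)

lemma clause_subset: "clause A \<Longrightarrow> B \<subseteq> A \<Longrightarrow> clause B"
  unfolding clause_iff by (meson finite_subset subsetD)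

lemma abs_in_var: "A \<in> F \<Longrightarrow> x \<in> A \<Longrightarrow> \<bar>x\<bar> \<in> var F"
  by (auto simp: var_def var_clause_def)

lemma abs_in_var_uminus: "A \<in> F \<Longrightarrow> - x \<in> A \<Longrightarrow> \<bar>x\<bar> \<in> var F"
  using abs_in_var[of A F "- x"] by simp

lemma finite_var: "clause_set F \<Longrightarrow> finite (var F)"
  by (auto simp: clause_set_def clause_def var_def var_clause_def)

lemma var_Un: "var (F \<union> H) = var F \<union> var H"
  by (auto simp: var_def)

lemma var_empty [simp]: "var {} = {}"
  by (simp add: var_def)

lemma var_mono: "H \<subseteq> F \<Longrightarrow> var H \<subseteq> var F"
  by (auto simp: var_def)

lemma ldeg_pos_iff: "finite F \<Longrightarrow> ldeg F x \<ge> 1 \<longleftrightarrow> (\<exists>A\<in>F. x \<in> A)"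
  by (auto simp: ldeg_def Suc_le_eq card_gt_0_iff)

lemma ldeg_eq_0: "\<bar>x\<bar> \<notin> var F \<Longrightarrow> ldeg F x = 0"
  unfolding ldeg_def using abs_in_var by (metis (mono_tags, lifting) card.empty empty_Collect_eq)

lemma ldeg_1_unique:
  assumes "ldeg F x = 1" "A \<in> F" "x \<in> A" "B \<in> F" "x \<in> B"
  shows "A = B"
proof -
  have "A \<in> {A \<in> F. x \<in> A}" "B \<in> {A \<in> F. x \<in> A}"
    using assms by auto
  then show ?thesis
    using assms(1) unfolding ldeg_def by (metis card_1_singletonE singletonD)
qed

lemma singular_varI:
  assumes "finite F" "ldeg F x = 1" "ldeg F (- x) \<ge> 1"
  shows "singular_var F \<bar>x\<bar>"
proof -
  obtain A where "A \<in> F" "x \<in> A"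
    using assms ldeg_pos_iff[of F x] by auto
  then have "\<bar>x\<bar> \<in> var F"
    by (rule abs_in_var)
  then show ?thesis
    using assms by (cases "x \<ge> 0") (auto simp: singular_var_def min_def)
qed

text \<open>Passing from the variable to its literal of degree one lets later arguments treat both
  signs at once.\<close>

lemma singular_varE:
  assumes "singular_var F v"
  obtains x where "v = \<bar>x\<bar>" "ldeg F x = 1" "ldeg F (- x) \<ge> 1"
proof -
  have "v \<ge> 0"
    using assms by (auto simp: singular_var_def var_def var_clause_def)
  moreover have "(ldeg F v = 1 \<and> ldeg F (- v) \<ge> 1) \<or> (ldeg F (- v) = 1 \<and> ldeg F (- (- v)) \<ge> 1)"
    using assms by (auto simp: singular_var_def min_def split: if_splits)
  ultimately show ?thesis
    using that[of v] that[of "- v"] by auto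
qed

lemma one_singular_varE:
  assumes "one_singular_var F v"
  obtains "v \<ge> 0" "v \<in> var F" "ldeg F v = 1" "ldeg F (- v) = 1"
proof -
  have "v \<ge> 0"
    using assms by (auto simp: one_singular_var_def singular_var_def var_def var_clause_def)
  moreover have "v \<in> var F" "ldeg F v = 1" "ldeg F (- v) = 1"
    using assms by (auto simp: one_singular_var_def singular_var_def min_def split: if_splits)
  ultimately show ?thesis
    using that by auto
qed

lemma finite_varsing: "clause_set F \<Longrightarrow> finite (varsing F)"
  by (rule finite_subset[OF _ finite_var]) (auto simp: varsing_def singular_var_def)

text \<open>\<open>T\<close> may be infinite and thus no clause. Cutting it down to the literals
  occurring in \<open>F\<close> makes it one without changing which clauses of \<open>F\<close> it
  meets.\<close>

lemma unsat_falsified_clause: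
  assumes F: "clause_set F" "unsatisfiable F"
    and T: "0 \<notin> T" "\<And>x. x \<in> T \<Longrightarrow> - x \<notin> T"
  obtains A where "A \<in> F" "A \<inter> T = {}"
proof -
  have "finite (\<Union>F)"
    using F(1) by (auto simp: clause_set_def clause_def)
  then have "clause (T \<inter> \<Union>F)"
    using T by (auto simp: clause_iff)
  then obtain A where "A \<in> F" "(T \<inter> \<Union>F) \<inter> A = {}"
    using F(2) by (auto simp: satisfiable_def)
  then show ?thesis
    using that by blast
qed

section \<open>Tarsi's lemma for hitting clause-sets\<close>

text \<open>A marriage argument that avoids the forbidden variables \<open>W\<close>. Either some
  nonempty proper subset is tight and the problem splits in two, or all of them have slack and one
  clause may be satisfied by any of its literals outside \<open>W\<close>. \<open>W\<close> varies
  in the induction because it collects the variables already spent.\<close>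

lemma hall_satisfiable:
  assumes "clause_set F" "finite W"
    and "\<And>H. H \<subseteq> F \<Longrightarrow> card H \<le> card (var H - W)"
  shows "\<exists>P. clause P \<and> var_clause P \<subseteq> var F - W \<and> (\<forall>A\<in>F. P \<inter> A \<noteq> {})"
  using assms
proof (induction "card F" arbitrary: F W rule: less_induct)
  case less
  note F = \<open>clause_set F\<close> and W = \<open>finite W\<close> and hall = less.prems(3)
  have fin: "finite F"
    using F by (rule clause_set_finite)
  consider "F = {}"
    | H where "H \<noteq> {}" "H \<subset> F" "card H = card (var H - W)"
    | "F \<noteq> {}" "\<And>H. H \<noteq> {} \<Longrightarrow> H \<subset> F \<Longrightarrow> card H < card (var H - W)"
    using hall by (metis le_neq_implies_less psubset_imp_subset)
  then show ?case
  proof cases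
    case 1
    then show ?thesis
      by (intro exI[of _ "{}"]) (auto simp: clause_iff var_clause_def)
  next
    case (2 H)
    have clH: "clause_set H" and clK: "clause_set (F - H)"
      using clause_set_subset[OF F] 2 by auto
    have finH: "finite H"
      using clH by (rule clause_set_finite)
    have "card H < card F"
      using 2(2) fin by (simp add: psubset_card_mono)
    then obtain P where P: "clause P" "var_clause P \<subseteq> var H - W" "\<forall>A\<in>H. P \<inter> A \<noteq> {}"
      using less.hyps[OF _ clH W] hall 2 by (meson order_trans psubset_imp_subset)
    \<comment> \<open>Hall's condition for \<open>K \<union> H\<close>, minus the tightness equation
      of \<open>H\<close>.\<close>
    have "card K \<le> card (var K - (W \<union> var H))" if K: "K \<subseteq> F - H" for K
    proof -
      have clK': "clause_set K"
        using clause_set_subset[OF clK K] .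
      have "card K + card H = card (K \<union> H)"
        using K finH clause_set_finite[OF clK'] by (subst card_Un_disjoint) auto
      also have "\<dots> \<le> card (var (K \<union> H) - W)"
        using hall[of "K \<union> H"] K 2 by auto
      also have "var (K \<union> H) - W = (var K - (W \<union> var H)) \<union> (var H - W)"
        by (auto simp: var_Un)
      also have "card \<dots> = card (var K - (W \<union> var H)) + card (var H - W)"
        using finite_var[OF clK'] finite_var[OF clH] by (subst card_Un_disjoint) auto
      finally show ?thesis
        using 2 by simp
    qed
    moreover have "card (F - H) < card F"
      using 2 fin by (intro psubset_card_mono) auto
    ultimately obtain Q where Q: "clause Q" "var_clause Q \<subseteq> var (F - H) - (W \<union> var H)"
        "\<forall>A\<in>F - H. Q \<inter> A \<noteq> {}"
      using less.hyps[OF _ clK, of "W \<union> var H"] W finite_var[OF clH] by auto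
    have disj: "\<bar>x\<bar> \<noteq> \<bar>y\<bar>" if "x \<in> P" "y \<in> Q" for x y
      using that P(2) Q(2) unfolding var_clause_def
      by (metis (no_types, lifting) DiffD1 DiffD2 UnI2 imageI subsetD)
    have "clause (P \<union> Q)"
      using P(1) Q(1) disj unfolding clause_iff by (metis Un_iff abs_minus_cancel finite_Un)
    moreover have "var_clause (P \<union> Q) \<subseteq> var F - W"
      using P(2) Q(2) var_mono[of H F] var_mono[of "F - H" F] 2(2)
      by (auto simp: var_clause_def)
    ultimately show ?thesis
      using P(3) Q(3) by (intro exI[of _ "P \<union> Q"]) blast
  next
    case 3
    then obtain A where A: "A \<in> F"
      by auto
    have "card (var {A} - W) \<ge> 1"
      using hall[of "{A}"] A by simp
    then have "var {A} - W \<noteq> {}"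
      by (metis card.empty not_one_le_zero)
    then obtain x where x: "x \<in> A" "\<bar>x\<bar> \<notin> W"
      by (auto simp: var_def var_clause_def)
    have cl: "clause_set (F - {A})"
      using clause_set_subset[OF F] by auto
    \<comment> \<open>Forbidding one more variable costs at most one, which the strict inequality
      absorbs.\<close>
    have "card K \<le> card (var K - (insert \<bar>x\<bar> W))" if K: "K \<subseteq> F - {A}" for K
    proof (cases "K = {}")
      case False
      then have "card K < card (var K - W)"
        using 3(2)[of K] K A by blast
      also have "card (var K - W) \<le> card (insert \<bar>x\<bar> (var K - insert \<bar>x\<bar> W))"
        using finite_var[OF clause_set_subset[OF cl K]] by (intro card_mono) auto
      also have "\<dots> \<le> Suc (card (var K - insert \<bar>x\<bar> W))"
        by (rule card_insert_le_m1) auto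
      finally show ?thesis
        by simp
    qed simp
    moreover have "card (F - {A}) < card F"
      using A fin by (intro psubset_card_mono) auto
    ultimately obtain P where P: "clause P" "var_clause P \<subseteq> var (F - {A}) - insert \<bar>x\<bar> W"
        "\<forall>B\<in>F - {A}. P \<inter> B \<noteq> {}"
      using less.hyps[OF _ cl, of "insert \<bar>x\<bar> W"] W by auto
    have disj: "\<bar>y\<bar> \<noteq> \<bar>x\<bar>" if "y \<in> P" for y
      using that P(2) by (auto simp: var_clause_def)
    have "x \<noteq> 0"
      using clause_setD[OF F A] x by (auto simp: clause_iff)
    then have "clause (insert x P)"
      using P(1) disj by (fastforce simp: clause_iff)
    moreover have "var_clause (insert x P) \<subseteq> var F - W"
      using P(2) var_mono[of "F - {A}" F] x abs_in_var[OF A x(1)]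
      by (auto simp: var_clause_def)
    ultimately show ?thesis
      using P(3) x by (intro exI[of _ "insert x P"]) blast
  qed
qed

text \<open>A subset of maximal deficiency leaves a rest that Hall's condition makes satisfiable
  without touching the variables of the subset.\<close>

lemma deficiency_pos:
  assumes "unsat_hitting_clause_set F"
  shows "deficiency F \<ge> 1"
proof -
  have F: "clause_set F" and unsat: "unsatisfiable F" and hit: "hitting F"
    using assms by (auto simp: unsat_hitting_clause_set_def)
  have fin: "finite F"
    using F by (rule clause_set_finite)
  \<comment> \<open>General in \<open>H\<close> because it is applied twice: to a maximiser, and at
    the end to \<open>{}\<close>.\<close>
  have only_F: "H = F" if H: "H \<subseteq> F" and max: "\<And>K. K \<subseteq> F \<Longrightarrow> deficiency K \<le> deficiency H" for H
  proof (rule ccontr)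
    assume "H \<noteq> F"
    then obtain A where A: "A \<in> F" "A \<notin> H"
      using H by auto
    have clH: "clause_set H" and clK: "clause_set (F - H)"
      using clause_set_subset[OF F] H by auto
    \<comment> \<open>Maximality of \<open>H\<close> against \<open>K \<union> H\<close> is exactly
      Hall's condition for \<open>K\<close> with \<open>var H\<close> forbidden.\<close>
    have "card K \<le> card (var K - var H)" if K: "K \<subseteq> F - H" for K
    proof -
      have clK': "clause_set K"
        using clause_set_subset[OF clK K] .
      have "card (K \<union> H) = card K + card H"
        using K clause_set_finite[OF clK'] clause_set_finite[OF clH] by (subst card_Un_disjoint) auto
      moreover have "card (var (K \<union> H)) = card (var K - var H) + card (var H)"
        using finite_var[OF clK'] finite_var[OF clH]
        by (subst card_Un_disjoint[symmetric]) (auto simp: var_Un)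
      moreover have "deficiency (K \<union> H) \<le> deficiency H"
        using max[of "K \<union> H"] K H by auto
      ultimately show ?thesis
        by (simp add: deficiency_def num_cls_def num_var_def)
    qed
    then obtain P where P: "clause P" "var_clause P \<subseteq> var (F - H) - var H"
        "\<forall>B\<in>F - H. P \<inter> B \<noteq> {}"
      using hall_satisfiable[OF clK finite_var[OF clH]] by blast
    \<comment> \<open>\<open>A\<close> lies outside \<open>H\<close>, so it clashes with every
      clause of \<open>H\<close>. Restricting to \<open>var H\<close> keeps \<open>Q\<close> free of
      conflicts with \<open>P\<close>.\<close>
    define Q where "Q = {x \<in> complement A. \<bar>x\<bar> \<in> var H}"
    have "clause Q"
      by (rule clause_subset[OF clause_complement[OF clause_setD[OF F A(1)]]]) (auto simp: Q_def)
    moreover have disj: "\<bar>x\<bar> \<noteq> \<bar>y\<bar>" if "x \<in> P" "y \<in> Q" for x y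
      using that P(2) by (auto simp: Q_def var_clause_def)
    ultimately have "clause (P \<union> Q)"
      using P(1) unfolding clause_iff by (metis Un_iff abs_minus_cancel finite_Un)
    moreover have "Q \<inter> B \<noteq> {}" if B: "B \<in> H" for B
    proof -
      obtain x where "x \<in> B" "- x \<in> A"
        using hit A B H unfolding hitting_def by (metis subsetD)
      then show ?thesis
        using abs_in_var[OF B] by (auto simp: Q_def)
    qed
    ultimately have "satisfiable F"
      unfolding satisfiable_def using P(3) by (intro exI[of _ "P \<union> Q"]) blast
    then show False
      using unsat by simp
  qed
  obtain H where H: "H \<in> Pow F" "\<And>K. K \<in> Pow F \<Longrightarrow> deficiency K \<le> deficiency H"
  proof -
    let ?D = "deficiency ` Pow F"
    have "finite ?D" "?D \<noteq> {}"
      using fin by auto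
    then have "Max ?D \<in> ?D" "\<And>K. K \<in> Pow F \<Longrightarrow> deficiency K \<le> Max ?D"
      by (auto intro: Max_ge simp: Max_in)
    then show ?thesis
      using that by (metis imageE)
  qed
  then have "H = F"
    using only_F by auto
  have "clause {}"
    by (simp add: clause_iff)
  then have "F \<noteq> {}"
    using unsat by (auto simp: satisfiable_def)
  have "deficiency F > 0"
  proof (rule ccontr)
    assume "\<not> deficiency F > 0"
    \<comment> \<open>\<open>F\<close> is a maximiser, so a nonpositive value would make
      \<open>{}\<close>, of deficiency 0, a maximiser as well.\<close>
    then have "deficiency K \<le> deficiency {}" if "K \<subseteq> F" for K
      using H(2)[of K] that \<open>H = F\<close> by (auto simp: deficiency_def num_cls_def num_var_def)
    then show False
      using only_F[of "{}"] \<open>F \<noteq> {}\<close> by auto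
  qed
  then show ?thesis
    by simp
qed

section \<open>Literals of degree one\<close>

text \<open>The source of the \<open>+ 1\<close> in the bound on \<open>nsv F0\<close>.\<close>

lemma unsat_hitting_degree_one_literal_unique:
  assumes F: "clause_set F" "unsatisfiable F" "hitting F"
    and C: "C \<in> F" "x \<in> C" "y \<in> C" "ldeg F x = 1" "ldeg F y = 1"
  shows "x = y"
proof (rule ccontr)
  assume "x \<noteq> y"
  have C_cl: "0 \<notin> C" "\<And>z. z \<in> C \<Longrightarrow> - z \<notin> C"
    using clause_setD[OF F(1) C(1)] by (auto simp: clause_iff)
  \<comment> \<open>A total assignment falsifying \<open>C\<close>; flipping \<open>x\<close> or \<open>y\<close> falsifies clauses \<open>A\<close> and \<open>B\<close>, and both
    remain falsified when the two literals are flipped together.\<close>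
  define T where "T = complement C \<union> {n. n > 0 \<and> n \<notin> C \<and> - n \<notin> C}"
  have T0: "0 \<notin> T"
    using C_cl by (auto simp: T_def)
  have T: "z \<in> T \<longleftrightarrow> - z \<notin> T" if "z \<noteq> 0" for z
    using that C_cl(2)[of z] by (auto simp: T_def)
  have flip: "\<exists>A\<in>F. - u \<in> A \<and> A \<inter> T \<subseteq> {- u} \<and> w \<notin> A \<and> - w \<notin> A"
    if uw: "u \<in> C" "w \<in> C" "u \<noteq> w" "ldeg F u = 1" "ldeg F w = 1" for u w
  proof -
    let ?T = "insert u (T - {- u})"
    have u0: "u \<noteq> 0" and wu: "w \<noteq> - u"
      using C_cl uw by auto
    have "- z \<notin> ?T" if "z \<in> ?T" for z
    proof (cases "z = u")
      case False
      then have "z \<in> T" "z \<noteq> - u"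
        using that by auto
      moreover have "- z \<notin> T"
        using \<open>z \<in> T\<close> T[of z] T0 by metis
      ultimately show ?thesis
        by auto
    qed (use u0 in auto)
    moreover have "0 \<notin> ?T"
      using T0 u0 by simp
    ultimately obtain A where A: "A \<in> F" "A \<inter> ?T = {}"
      using unsat_falsified_clause[OF F(1,2)] by metis
    have "A \<noteq> C"
      using A uw by auto
    \<comment> \<open>The clash with \<open>C\<close> takes place at a literal of \<open>T\<close>,
      and \<open>- u\<close> is the only one that \<open>A\<close> may contain.\<close>
    then obtain z where z: "z \<in> A" "- z \<in> C"
      using F(3) A C(1) unfolding hitting_def by metis
    then have "z \<in> T"
      by (auto simp: T_def)
    then have "- u \<in> A"
      using A z by auto
    moreover have "w \<notin> A"
      using ldeg_1_unique[OF uw(5) A(1) _ C(1) uw(2)] \<open>A \<noteq> C\<close> by auto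
    moreover have "- w \<in> ?T"
      using uw wu by (auto simp: T_def)
    then have "- w \<notin> A"
      using A by auto
    ultimately show ?thesis
      using A by blast
  qed
  obtain A where A: "A \<in> F" "- x \<in> A" "A \<inter> T \<subseteq> {- x}" "y \<notin> A" "- y \<notin> A"
    using flip[of x y] C \<open>x \<noteq> y\<close> by auto
  obtain B where B: "B \<in> F" "- y \<in> B" "B \<inter> T \<subseteq> {- y}" "x \<notin> B" "- x \<notin> B"
    using flip[of y x] C \<open>x \<noteq> y\<close> by auto
  have "A \<noteq> B"
    using A B by auto
  \<comment> \<open>\<open>z \<in> T\<close> forces \<open>z = - x\<close>, hence
    \<open>x \<in> B\<close>; \<open>- z \<in> T\<close> forces \<open>z = y\<close>, hence
    \<open>y \<in> A\<close>. Both are excluded.\<close>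
  then obtain z where z: "z \<in> A" "- z \<in> B"
    using F(3) A B unfolding hitting_def by metis
  then have "z \<noteq> 0"
    using clause_setD[OF F(1) A(1)] by (auto simp: clause_iff)
  then have "z \<in> T \<or> - z \<in> T"
    using T by blast
  then show False
    using z A B by auto
qed

text \<open>One inclusion suffices: exchanging \<open>x\<close> and \<open>- x\<close> gives the
  other, so \<open>A\<close> and \<open>B\<close> form an fs-pair.\<close>

lemma one_singular_half:
  assumes F: "clause_set F" "unsatisfiable F" "hitting F"
    and A: "A \<in> F" "x \<in> A" and B: "B \<in> F" "- x \<in> B"
    and deg: "ldeg F x = 1" "ldeg F (- x) = 1"
  shows "B - {- x} \<subseteq> A - {x}"
proof
  fix y assume y: "y \<in> B - {- x}"
  have cl: "clause A" "clause B"
    using F A B clause_setD by auto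
  have "y \<noteq> x" "y \<noteq> - x" "y \<noteq> 0" "x \<noteq> 0"
    using y cl A B by (auto simp: clause_iff)
  show "y \<in> A - {x}"
  proof (rule ccontr)
    assume "y \<notin> A - {x}"
    then have "y \<notin> A"
      using \<open>y \<noteq> x\<close> by simp
    \<comment> \<open>Flipping \<open>x\<close> in the assignment falsifying \<open>A\<close> and adding \<open>y\<close> would satisfy \<open>F\<close>.\<close>
    define P where "P = insert x (insert y (complement (A - {x})))"
    have "0 \<notin> P" "\<And>z. z \<in> P \<Longrightarrow> - z \<notin> P"
      using cl(1) A \<open>y \<notin> A\<close> \<open>y \<noteq> x\<close> \<open>y \<noteq> - x\<close> \<open>y \<noteq> 0\<close> \<open>x \<noteq> 0\<close>
      by (auto simp: P_def clause_iff)
    then obtain D where D: "D \<in> F" "D \<inter> P = {}"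
      using unsat_falsified_clause[OF F(1,2)] by metis
    have "D \<noteq> A" "D \<noteq> B"
      using D A y by (auto simp: P_def)
    then have "- x \<notin> D"
      using ldeg_1_unique[OF deg(2) D(1) _ B] by auto
    \<comment> \<open>\<open>D\<close> lacks \<open>- x\<close>, so its clash with \<open>A\<close>
      lies in \<open>A - {x}\<close>, whose complement is part of \<open>P\<close>.\<close>
    obtain z where "z \<in> D" "- z \<in> A"
      using F(3) D A \<open>D \<noteq> A\<close> unfolding hitting_def by metis
    moreover from this have "z \<in> P"
      using \<open>- x \<notin> D\<close> by (auto simp: P_def)
    ultimately show False
      using D(2) by blast
  qed
qed

lemma one_singular_fs_pair:
  assumes F: "clause_set F" "unsatisfiable F" "hitting F" and v: "one_singular_var F v"
  obtains E where "v \<notin> E" "- v \<notin> E" "v \<noteq> 0" "insert v E \<in> F" "insert (- v) E \<in> F"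
proof -
  have deg: "ldeg F v = 1" "ldeg F (- v) = 1"
    using v by (auto elim: one_singular_varE)
  obtain A B where A: "A \<in> F" "v \<in> A" and B: "B \<in> F" "- v \<in> B"
    using deg ldeg_pos_iff[OF clause_set_finite[OF F(1)]] by (metis order_refl)
  have "B - {- v} \<subseteq> A - {v}"
    using one_singular_half[OF F A B deg] .
  moreover have "A - {v} \<subseteq> B - {- v}"
    using one_singular_half[OF F B, of A] A deg by simp
  ultimately have eq: "A - {v} = B - {- v}"
    by auto
  have "clause A"
    using F A clause_setD by auto
  then have "v \<notin> A - {v}" "- v \<notin> A - {v}" "v \<noteq> 0"
    using A by (auto simp: clause_iff)
  moreover have "insert v (A - {v}) = A" "insert (- v) (A - {v}) = B"
    using A B eq by auto
  ultimately show ?thesis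
    using that[of "A - {v}"] A B by auto
qed

text \<open>Strictness comes from nonsingularity: \<open>w\<close> occurs in a further clause, so
  its variable survives the resolution, while \<open>E\<close> keeps all other variables of the
  pair.\<close>

lemma nonsingular_fs_pair_strictly_resolvable:
  assumes F: "clause_set F" "hitting F" "nonsingular F"
    and E: "w \<notin> E" "- w \<notin> E" "w \<noteq> 0" "insert w E \<in> F" "insert (- w) E \<in> F"
  shows "strictly_fs_resolvable F"
proof -
  let ?F' = "(F - {E \<union> {w}, E \<union> {- w}}) \<union> {E}"
  have fin: "finite F"
    using F(1) by (rule clause_set_finite)
  have "clause (insert w E)"
    using F E clause_setD by auto
  then have E_cl: "clause E"
    by (auto simp: clause_iff)
  have "E \<noteq> insert w E"
    using E by auto
  \<comment> \<open>In \<open>F\<close>, the clause \<open>E\<close> would have to clash with its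
    superset \<open>insert w E\<close>, which is itself free of complementary literals.\<close>
  then have "E \<notin> F"
    using F(2) E E_cl unfolding hitting_def clause_iff by (metis insertE minus_minus)
  then have fs: "fs_resolution F ?F'"
    unfolding fs_resolution_def using E E_cl by (intro exI[of _ E] exI[of _ w]) auto
  have "ldeg F w \<noteq> 1"
  proof
    assume "ldeg F w = 1"
    moreover have "ldeg F (- w) \<ge> 1"
      using ldeg_pos_iff[OF fin, of "- w"] E by auto
    ultimately show False
      using singular_varI[OF fin] F(3) by (auto simp: nonsingular_def varsing_def)
  qed
  then have "{A \<in> F. w \<in> A} \<noteq> {insert w E}"
    unfolding ldeg_def by (metis is_singletonI is_singleton_altdef)
  then obtain A where A: "A \<in> F" "w \<in> A" "A \<noteq> insert w E"
    using E by auto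
  have "w \<notin> insert (- w) E"
    using E by auto
  then have "A \<in> ?F'"
    using A by auto
  then have w: "\<bar>w\<bar> \<in> var ?F'"
    using A(2) by (rule abs_in_var)
  have "var ?F' = var F"
  proof
    show "var ?F' \<subseteq> var F"
    proof -
      have "var {E} \<subseteq> var {insert w E}"
        by (auto simp: var_def var_clause_def)
      also have "\<dots> \<subseteq> var F"
        using E(4) by (intro var_mono) simp
      finally show ?thesis
        unfolding var_Un using var_mono[OF Diff_subset] by (intro Un_least)
    qed
    show "var F \<subseteq> var ?F'"
    proof
      fix v assume "v \<in> var F"
      then obtain B y where B: "B \<in> F" "y \<in> B" "v = \<bar>y\<bar>"
        by (auto simp: var_def var_clause_def)
      show "v \<in> var ?F'"
      proof (cases "B \<in> ?F'")
        case True
        then show ?thesis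
          using abs_in_var[of B ?F' y] B by simp
      next
        case False
        then have "y \<in> E \<or> \<bar>y\<bar> = \<bar>w\<bar>"
          using B by auto
        then show ?thesis
          using w B abs_in_var[of E ?F' y] by auto
      qed
    qed
  qed
  then show ?thesis
    using fs unfolding strictly_fs_resolvable_def strict_fs_resolution_def by blast
qed

section \<open>Clause-factorisations\<close>

locale factorisation =
  fixes F0 G F :: "int set set" and C :: "int set"
  assumes fact: "clause_factorisation F0 C G"
  defines "F \<equiv> diamond F0 C G"
begin

lemma F0: "clause_set F0" and G: "clause_set G" and C: "C \<in> F0"
  and G_unsat: "unsatisfiable G"
  using fact by (auto simp: clause_factorisation_def)

lemma C_lit: "x \<in> C \<Longrightarrow> \<bar>x\<bar> \<notin> var G"
  using fact by (auto simp: clause_factorisation_def var_clause_def)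

lemma C_G_lit:
  assumes "x \<in> C" "D \<in> G"
  shows "x \<notin> D" "- x \<notin> D"
  using C_lit[OF assms(1)] abs_in_var[OF assms(2)] abs_in_var_uminus[OF assms(2)] by auto

lemma C_clause: "0 \<notin> C" "x \<in> C \<Longrightarrow> - x \<notin> C"
  using clause_setD[OF F0 C] by (auto simp: clause_iff)

lemma G_nonempty: "G \<noteq> {}"
proof -
  have "clause {}"
    by (simp add: clause_iff)
  then show ?thesis
    using G_unsat by (auto simp: satisfiable_def)
qed

text \<open>The side condition of \<open>extend_clause\<close> always holds here, since
  \<open>C\<close> and \<open>G\<close> share no variable.\<close>

lemma extend_clause_eq: "extend_clause C G = (\<union>) C ` G"
proof -
  have "C \<inter> complement D = {}" if "D \<in> G" for D
    using C_G_lit(2)[OF _ that] by auto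
  then show ?thesis
    unfolding extend_clause_def by blast
qed

lemma F_eq: "F = (F0 - {C}) \<union> (\<union>) C ` G"
  by (simp add: F_def diamond_def extend_clause_eq)

lemma disjoint: "(F0 - {C}) \<inter> (\<union>) C ` G = {}"
  using fact by (auto simp: clause_factorisation_def extend_clause_eq)

lemma inj: "inj_on ((\<union>) C) G"
proof (rule inj_onI)
  fix D D' assume "D \<in> G" "D' \<in> G" "C \<union> D = C \<union> D'"
  then show "D = D'"
    using C_G_lit(1) by blast
qed

lemma F_clause_set: "clause_set F"
proof -
  have "clause (C \<union> D)" if "D \<in> G" for D
    using clause_setD[OF F0 C] clause_setD[OF G that] C_G_lit(2)[OF _ that]
    unfolding clause_iff by (metis Un_iff finite_Un minus_minus)
  then show ?thesis
    using F0 G by (auto simp: F_eq clause_set_def)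
qed

lemma card_F: "card F + 1 = card F0 + card G"
proof -
  have "card F = card (F0 - {C}) + card ((\<union>) C ` G)"
    unfolding F_eq using clause_set_finite[OF F0] clause_set_finite[OF G] disjoint
    by (intro card_Un_disjoint) auto
  then show ?thesis
    using card_Suc_Diff1[OF clause_set_finite[OF F0] C] by (simp add: card_image[OF inj])
qed

lemma var_F: "var F = var F0 \<union> var G"
proof -
  have "var ((\<union>) C ` G) = var {C} \<union> var G"
    using G_nonempty by (auto simp: var_def var_clause_def)
  moreover have "var F0 = var (F0 - {C}) \<union> var {C}"
    using C by (auto simp: var_def)
  ultimately show ?thesis
    by (auto simp: F_eq var_Un)
qed

text \<open>Literals of \<open>C\<close> are excluded because they are copied into every
  \<open>C \<union> D\<close>, so additivity may fail for them.\<close>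

lemma ldeg_F:
  assumes "x \<notin> C"
  shows "ldeg F x = ldeg F0 x + ldeg G x"
proof -
  have "{A \<in> F. x \<in> A} = {A \<in> F0. x \<in> A} \<union> (\<union>) C ` {D \<in> G. x \<in> D}"
    using assms by (auto simp: F_eq)
  also have "card \<dots> = card {A \<in> F0. x \<in> A} + card ((\<union>) C ` {D \<in> G. x \<in> D})"
    using clause_set_finite[OF F0] clause_set_finite[OF G] disjoint assms
    by (intro card_Un_disjoint) auto
  also have "card ((\<union>) C ` {D \<in> G. x \<in> D}) = card {D \<in> G. x \<in> D}"
    by (intro card_image inj_on_subset[OF inj]) auto
  finally show ?thesis
    by (simp add: ldeg_def)
qed

text \<open>This covers literals of \<open>C\<close> too: \<open>G\<close> is nonempty, so
  \<open>C\<close> survives inside some \<open>C \<union> D\<close>.\<close>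

lemma ldeg_F_pos:
  assumes "ldeg F0 x \<ge> 1"
  shows "ldeg F x \<ge> 1"
proof -
  obtain A where A: "A \<in> F0" "x \<in> A"
    using assms ldeg_pos_iff[OF clause_set_finite[OF F0]] by auto
  then have "\<exists>B\<in>F. x \<in> B"
    using G_nonempty by (cases "A = C") (auto simp: F_eq)
  then show ?thesis
    using ldeg_pos_iff[OF clause_set_finite[OF F_clause_set]] by auto
qed

section \<open>Transfer of unsatisfiability and the hitting property\<close>

lemma hitting_F:
  assumes "hitting F0" "hitting G"
  shows "hitting F"
  unfolding hitting_def
proof (intro ballI impI)
  fix A B assume AB: "A \<in> F" "B \<in> F" "A \<noteq> B"
  have C_hits: "\<exists>x\<in>A'. - x \<in> C" "\<exists>x\<in>C. - x \<in> A'" if "A' \<in> F0 - {C}" for A'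
    using assms(1) C that unfolding hitting_def by auto
  consider "A \<in> F0 - {C}" "B \<in> F0 - {C}"
    | D where "A \<in> F0 - {C}" "D \<in> G" "B = C \<union> D"
    | D where "B \<in> F0 - {C}" "D \<in> G" "A = C \<union> D"
    | D D' where "D \<in> G" "D' \<in> G" "A = C \<union> D" "B = C \<union> D'"
    using AB unfolding F_eq by blast
  then show "\<exists>x\<in>A. - x \<in> B"
  proof cases
    case 1
    then show ?thesis
      using assms(1) AB unfolding hitting_def by auto
  next
    case 2
    then show ?thesis
      using C_hits by auto
  next
    case 3
    then show ?thesis
      using C_hits by auto
  next
    case (4 D D')
    then have "\<exists>x\<in>D. - x \<in> D'"
      using assms(2) AB unfolding hitting_def by metis
    then show ?thesis
      using 4 by auto
  qed
qed

text \<open>An assignment satisfying \<open>F\<close> must meet \<open>C\<close>, since otherwise it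
  would meet every clause of the unsatisfiable \<open>G\<close>.\<close>

lemma satisfiable_F_iff: "satisfiable F \<longleftrightarrow> satisfiable F0"
proof
  assume "satisfiable F"
  then obtain P where P: "clause P" "\<And>A. A \<in> F \<Longrightarrow> P \<inter> A \<noteq> {}"
    by (auto simp: satisfiable_def)
  have "P \<inter> C \<noteq> {}"
  proof
    assume PC: "P \<inter> C = {}"
    have "P \<inter> D \<noteq> {}" if "D \<in> G" for D
      using P(2)[of "C \<union> D"] that PC by (auto simp: F_eq)
    then show False
      using P(1) G_unsat by (auto simp: satisfiable_def)
  qed
  then have "P \<inter> A \<noteq> {}" if "A \<in> F0" for A
    using P(2)[of A] that by (cases "A = C") (auto simp: F_eq)
  then show "satisfiable F0"
    using P(1) by (auto simp: satisfiable_def)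
next
  assume "satisfiable F0"
  then obtain P where P: "clause P" "\<And>A. A \<in> F0 \<Longrightarrow> P \<inter> A \<noteq> {}"
    by (auto simp: satisfiable_def)
  have "P \<inter> A \<noteq> {}" if "A \<in> F" for A
    using that P(2)[of A] P(2)[OF C] by (auto simp: F_eq)
  then show "satisfiable F"
    using P(1) by (auto simp: satisfiable_def)
qed

text \<open>A clash between \<open>C \<union> D\<close> and \<open>C \<union> D'\<close> cannot
  involve a literal of \<open>C\<close>, so it descends to \<open>D\<close> and
  \<open>D'\<close>.\<close>

lemma hitting_G:
  assumes "hitting F"
  shows "hitting G"
  unfolding hitting_def
proof (intro ballI impI)
  fix D D' assume D: "D \<in> G" "D' \<in> G" "D \<noteq> D'"
  then have "C \<union> D \<noteq> C \<union> D'"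
    using inj by (auto dest: inj_onD)
  moreover have "C \<union> D \<in> F" "C \<union> D' \<in> F"
    using D by (auto simp: F_eq)
  ultimately obtain x where "x \<in> C \<union> D" "- x \<in> C \<union> D'"
    using assms unfolding hitting_def by metis
  then show "\<exists>x\<in>D. - x \<in> D'"
    using C_clause(2)[of x] C_G_lit(2)[of x D'] C_G_lit(2)[of "- x" D] D by auto
qed

lemma hitting_F0:
  assumes "hitting F"
  shows "hitting F0"
proof -
  have C_hits: "\<exists>x\<in>A. - x \<in> C" if A: "A \<in> F0 - {C}" for A
  proof (rule ccontr)
    assume no: "\<not> (\<exists>x\<in>A. - x \<in> C)"
    have "complement A \<inter> D \<noteq> {}" if D: "D \<in> G" for D
    proof -
      \<comment> \<open>Disjointness of the two parts of the factorisation keeps \<open>A\<close>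
        distinct from \<open>C \<union> D\<close>, so that hitting applies.\<close>
      have "A \<in> F" "C \<union> D \<in> F" "A \<noteq> C \<union> D"
        using A D disjoint by (auto simp: F_eq)
      then obtain x where "x \<in> A" "- x \<in> C \<union> D"
        using assms unfolding hitting_def by metis
      then have "- x \<in> complement A \<inter> D"
        using no by auto
      then show ?thesis
        by blast
    qed
    moreover have "clause (complement A)"
      using clause_complement[OF clause_setD[OF F0]] A by auto
    ultimately show False
      using G_unsat by (auto simp: satisfiable_def)
  qed
  show ?thesis
    unfolding hitting_def
  proof (intro ballI impI)
    fix A B assume AB: "A \<in> F0" "B \<in> F0" "A \<noteq> B"
    consider "A = C" | "B = C" | "A \<in> F" "B \<in> F"
      using AB by (auto simp: F_eq)
    then show "\<exists>x\<in>A. - x \<in> B"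
    proof cases
      case 1
      then obtain x where "x \<in> B" "- x \<in> A"
        using C_hits[of B] AB by auto
      then show ?thesis
        by (intro bexI[of _ "- x"]) auto
    next
      case 2
      then show ?thesis
        using C_hits[of A] AB by auto
    next
      case 3
      then show ?thesis
        using assms AB unfolding hitting_def by auto
    qed
  qed
qed

lemma unsat_hitting_iff:
  "unsat_hitting_clause_set F0 \<and> unsat_hitting_clause_set G \<longleftrightarrow> unsat_hitting_clause_set F"
  unfolding unsat_hitting_clause_set_def
  using F0 G G_unsat F_clause_set satisfiable_F_iff hitting_F hitting_F0 hitting_G by metis

section \<open>Singular variables of the factors and the deficiency\<close>

lemma singular_F0_literal_in_C:
  assumes ns: "nonsingular F" and x: "ldeg F0 x = 1" "ldeg F0 (- x) \<ge> 1" "\<bar>x\<bar> \<notin> var G"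
  shows "x \<in> C"
proof (rule ccontr)
  assume "x \<notin> C"
  then have "ldeg F x = 1"
    using ldeg_F x ldeg_eq_0 by simp
  \<comment> \<open>\<open>- x\<close> may belong to \<open>C\<close>, where degrees need not add
    up; positivity of its degree is enough.\<close>
  then have "singular_var F \<bar>x\<bar>"
    using singular_varI[OF clause_set_finite[OF F_clause_set]] ldeg_F_pos x by blast
  then show False
    using ns by (auto simp: nonsingular_def varsing_def)
qed

lemma varsing_G_subset:
  assumes "nonsingular F"
  shows "varsing G \<subseteq> var F0"
proof
  fix v assume "v \<in> varsing G"
  then obtain x where x: "v = \<bar>x\<bar>" "ldeg G x = 1" "ldeg G (- x) \<ge> 1"
    by (auto simp: varsing_def elim: singular_varE)
  show "v \<in> var F0"
  proof (rule ccontr)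
    assume v: "v \<notin> var F0"
    then have "x \<notin> C" "- x \<notin> C"
      using abs_in_var[OF C, of x] abs_in_var[OF C, of "- x"] x by auto
    then have "ldeg F x = 1" "ldeg F (- x) \<ge> 1"
      using x v ldeg_F ldeg_eq_0[of x F0] ldeg_eq_0[of "- x" F0] by auto
    then have "singular_var F \<bar>x\<bar>"
      using singular_varI[OF clause_set_finite[OF F_clause_set]] by blast
    then show False
      using assms by (auto simp: nonsingular_def varsing_def)
  qed
qed

lemma card_varsing_F0:
  assumes "nonsingular F" "unsat_hitting_clause_set F"
  shows "card (varsing F0) \<le> card (varsing F0 \<inter> var G) + 1"
proof -
  have uh: "unsatisfiable F0" "hitting F0"
    using assms(2) unsat_hitting_iff by (auto simp: unsat_hitting_clause_set_def)
  have lit: "\<exists>x\<in>C. v = \<bar>x\<bar> \<and> ldeg F0 x = 1" if v: "v \<in> varsing F0 - var G" for v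
  proof -
    obtain x where x: "v = \<bar>x\<bar>" "ldeg F0 x = 1" "ldeg F0 (- x) \<ge> 1"
      using v by (auto simp: varsing_def elim: singular_varE)
    then show ?thesis
      using singular_F0_literal_in_C[OF assms(1)] v by auto
  qed
  have "v = w" if "v \<in> varsing F0 - var G" "w \<in> varsing F0 - var G" for v w
    using lit[OF that(1)] lit[OF that(2)]
      unsat_hitting_degree_one_literal_unique[OF F0 uh C] by metis
  then have "card (varsing F0 - var G) \<le> 1"
    using card_le_Suc0_iff_eq[of "varsing F0 - var G"] finite_varsing[OF F0] by auto
  moreover have "card (varsing F0) = card (varsing F0 \<inter> var G) + card (varsing F0 - var G)"
    using finite_varsing[OF F0] by (subst card_Un_disjoint[symmetric]) (auto intro: arg_cong[of _ _ card])
  ultimately show ?thesis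
    by simp
qed

text \<open>The \<open>- 1\<close> accounts for the removed clause \<open>C\<close>, the last term
  for the variables counted in both factors.\<close>

lemma deficiency_F:
  "deficiency F = deficiency F0 + deficiency G - 1 + int (card (var F0 \<inter> var G))"
  using card_F card_Un_Int[OF finite_var[OF F0] finite_var[OF G]]
  by (simp add: deficiency_def num_cls_def num_var_def var_F)

text \<open>The contrapositive of (2a). An fs-pair of \<open>F0\<close> on \<open>v\<close> avoids
  \<open>C\<close> and passes to \<open>F\<close> unchanged; one of \<open>G\<close> passes after
  adding \<open>C\<close> to both clauses.\<close>

lemma one_singular_resolvable:
  assumes ns: "nonsingular F" and F: "unsat_hitting_clause_set F"
    and v: "one_singular_var F0 v \<or> one_singular_var G v"
  shows "strictly_fs_resolvable F"
proof -
  have uh: "unsatisfiable F0" "hitting F0" "hitting G" and hitF: "hitting F"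
    using F unsat_hitting_iff by (auto simp: unsat_hitting_clause_set_def)
  note resolvable = nonsingular_fs_pair_strictly_resolvable[OF F_clause_set hitF ns]
  show ?thesis
    using v
  proof
    assume v: "one_singular_var F0 v"
    then have v_deg: "v \<ge> 0" "ldeg F0 v = 1" "ldeg F0 (- v) = 1"
      by (auto elim: one_singular_varE)
    \<comment> \<open>Outside \<open>var G\<close>, both \<open>v\<close> and \<open>- v\<close>
      would be literals of degree one forced into \<open>C\<close>.\<close>
    have "v \<in> var G"
    proof (rule ccontr)
      assume "v \<notin> var G"
      then have "v \<in> C" "- v \<in> C"
        using singular_F0_literal_in_C[OF ns, of v] singular_F0_literal_in_C[OF ns, of "- v"] v_deg
        by auto
      then show False
        using C_clause(2) by blast
    qed
    then have "v \<notin> C" "- v \<notin> C"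
      using C_lit[of v] C_lit[of "- v"] v_deg by auto
    moreover obtain E where E: "v \<notin> E" "- v \<notin> E" "v \<noteq> 0" "insert v E \<in> F0" "insert (- v) E \<in> F0"
      using one_singular_fs_pair[OF F0 uh(1,2) v] .
    ultimately have "insert v E \<in> F" "insert (- v) E \<in> F"
      by (auto simp: F_eq)
    then show ?thesis
      using resolvable E by blast
  next
    assume v: "one_singular_var G v"
    then have "v \<ge> 0" "v \<in> var G"
      by (auto elim: one_singular_varE)
    then have "v \<notin> C" "- v \<notin> C"
      using C_lit[of v] C_lit[of "- v"] by auto
    moreover obtain E where E: "v \<notin> E" "- v \<notin> E" "v \<noteq> 0" "insert v E \<in> G" "insert (- v) E \<in> G"
      using one_singular_fs_pair[OF G G_unsat uh(3) v] .
    moreover have "insert v (C \<union> E) \<in> F" "insert (- v) (C \<union> E) \<in> F"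
      using E(4,5) unfolding F_eq by (metis UnI2 Un_insert_right imageI)+
    ultimately show ?thesis
      using resolvable[of v "C \<union> E"] by auto
  qed
qed

end

theorem lemma21:
  fixes F F0 G :: "int set set" and C :: "int set"
  assumes "clause_set F"
    and "clause_factorisation F0 C G"
    and "F = diamond F0 C G"
  shows "(unsat_hitting_clause_set F0 \<and> unsat_hitting_clause_set G
            \<longleftrightarrow> unsat_hitting_clause_set F)
       \<and> (nonsingular F \<and> unsat_hitting_clause_set F \<longrightarrow>
            (\<not> strictly_fs_resolvable F \<longrightarrow>
               \<not> (\<exists>v. one_singular_var F0 v) \<and> \<not> (\<exists>v. one_singular_var G v))
          \<and> (nsv F0 \<le> card (varsing F0 \<inter> var G) + 1
             \<and> card (varsing F0 \<inter> var G) + 1 \<le> card (var F0 \<inter> var G) + 1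
             \<and> int (card (var F0 \<inter> var G)) + 1 \<le> deficiency F)
          \<and> (nsv G \<le> card (var F0 \<inter> varsing G)
             \<and> card (var F0 \<inter> varsing G) \<le> card (var F0 \<inter> var G)
             \<and> int (card (var F0 \<inter> var G)) \<le> deficiency F - 1))"
proof -
  interpret factorisation F0 G F C
    by unfold_locales (simp_all add: assms)
  show ?thesis
  proof (intro conjI[OF unsat_hitting_iff] impI)
    assume "nonsingular F \<and> unsat_hitting_clause_set F"
    then have ns: "nonsingular F" and uh: "unsat_hitting_clause_set F"
      by auto
    have a: "\<not> strictly_fs_resolvable F \<longrightarrow>
        \<not> (\<exists>v. one_singular_var F0 v) \<and> \<not> (\<exists>v. one_singular_var G v)"
      using one_singular_resolvable[OF ns uh] by blast
    have "varsing F0 \<inter> var G \<subseteq> var F0 \<inter> var G"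
      by (auto simp: varsing_def singular_var_def)
    then have b: "card (varsing F0 \<inter> var G) \<le> card (var F0 \<inter> var G)"
      using finite_var[OF F0] by (intro card_mono) auto
    have "var F0 \<inter> varsing G \<subseteq> var F0 \<inter> var G"
      by (auto simp: varsing_def singular_var_def)
    then have c: "card (var F0 \<inter> varsing G) \<le> card (var F0 \<inter> var G)"
      using finite_var[OF F0] by (intro card_mono) auto
    \<comment> \<open>Both factors are unsatisfiable hitting by part (1), so each contributes
      deficiency at least 1.\<close>
    have d: "int (card (var F0 \<inter> var G)) + 1 \<le> deficiency F"
      using deficiency_F deficiency_pos[of F0] deficiency_pos[of G] uh unsat_hitting_iff by auto
    \<comment> \<open>The first inequality of (2c) is thus an equality.\<close>
    have "var F0 \<inter> varsing G = varsing G"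
      using varsing_G_subset[OF ns] by auto
    then show "(\<not> strictly_fs_resolvable F \<longrightarrow>
               \<not> (\<exists>v. one_singular_var F0 v) \<and> \<not> (\<exists>v. one_singular_var G v))
          \<and> (nsv F0 \<le> card (varsing F0 \<inter> var G) + 1
             \<and> card (varsing F0 \<inter> var G) + 1 \<le> card (var F0 \<inter> var G) + 1
             \<and> int (card (var F0 \<inter> var G)) + 1 \<le> deficiency F)
          \<and> (nsv G \<le> card (var F0 \<inter> varsing G)
             \<and> card (var F0 \<inter> varsing G) \<le> card (var F0 \<inter> var G)
             \<and> int (card (var F0 \<inter> var G)) \<le> deficiency F - 1)"
      using a b c d card_varsing_F0[OF ns uh] by (simp add: nsv_def)
  qed
qed

end
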